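(* Choose $x_0=x_1\in\mathbb{R}^d$ and let $\{x_k\}_{k\ge0}$ be the random iterates produced by the stochastic heavy ball method (SHB) with momentum parameter $0\le\beta<1$ and stepsize $\omega>0$ satisfying $\omega+2\beta<2$. Let $x_*$ be any vector with $f(x_* )=0$, and let $\hat{x}_k := \frac1k\sum_{t=1}^k x_t$. Then for all $k\ge1$, $$\mathbb{E}[f(\hat{x}_k)] \le \frac{(1-\beta)^2\|x_0-x_*\|^2 + 2\omega\beta f(x_0)}{2\omega(2-2\beta-\omega)\,k}.$$ (No exactness assumption is required.)
   Context: Let $\mathbf{A}\in\mathbb{R}^{m\times d}$ and $b\in\mathbb{R}^m$ be such that the linear system $\mathbf{A}x=b$ is consistent. Let $\mathcal{D}$ be a distribution over random matrices $\mathbf{S}$ with $m$ rows (and any number of columns). For such $\mathbf{S}$ let $\mathbf{H} := \mathbf{S}(\mathbf{S}^\top\mathbf{A}\mathbf{A}^\top\mathbf{S})^\dagger\mathbf{S}^\top$ ($\dagger$ = Moore–Penrose pseudoinverse); assume $\mathbb{E}_{\mathbf{S}\sim\mathcal{D}}[\mathbf{H}]$ exists and is finite. Define $f_{\mathbf{S}}(x) := \tfrac12 (\mathbf{A}x-b)^\top\mathbf{H}(\mathbf{A}x-b)$, so $\nabla f_{\mathbf{S}}(x) = \mathbf{A}^\top\mathbf{H}(\mathbf{A}x-b)$, and $f(x) := \mathbb{E}_{\mathbf{S}\sim\mathcal{D}}[f_{\mathbf{S}}(x)]$. The stochastic heavy ball method (SHB) with stepsize $\omega>0$ and momentum parameter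 $\beta\ge0$ generates, from starting points $x_0,x_1$, the iterates $x_{k+1} = x_k - \omega\nabla f_{\mathbf{S}_k}(x_k) + \beta(x_k-x_{k-1})$ for $k\ge1$, where $\mathbf{S}_k$ are drawn independently from $\mathcal{D}$ at each iteration. *)

theory Defs
  imports "HOL-Probability.Probability" "Jordan_Normal_Form.Matrix"
begin

text \<open>Moore-Penrose pseudoinverse of a real matrix (the unique matrix satisfying
  the four Penrose conditions; for real matrices conjugate transpose = transpose).\<close>
definition mp_pinv :: "real mat \<Rightarrow> real mat" where
  "mp_pinv M = (THE X. X \<in> carrier_mat (dim_col M) (dim_row M)
      \<and> M * X * M = M \<and> X * M * X = X
      \<and> transpose_mat (M * X) = M * X \<and> transpose_mat (X * M) = X * M)"

definition Hmat :: "real mat \<Rightarrow> real mat \<Rightarrow> real mat" where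
  "Hmat A S = S * mp_pinv (transpose_mat S * A * transpose_mat A * S) * transpose_mat S"

definition fS :: "real mat \<Rightarrow> real vec \<Rightarrow> real mat \<Rightarrow> real vec \<Rightarrow> real" where
  "fS A b S x = (1/2) * ((A *\<^sub>v x - b) \<bullet> (Hmat A S *\<^sub>v (A *\<^sub>v x - b)))"

definition fE :: "real mat measure \<Rightarrow> real mat \<Rightarrow> real vec \<Rightarrow> real vec \<Rightarrow> real" where
  "fE D A b x = (\<integral>S. fS A b S x \<partial>D)"

definition gradS :: "real mat \<Rightarrow> real vec \<Rightarrow> real mat \<Rightarrow> real vec \<Rightarrow> real vec" where
  "gradS A b S x = transpose_mat A *\<^sub>v (Hmat A S *\<^sub>v (A *\<^sub>v x - b))"

fun shb :: "real mat \<Rightarrow> real vec \<Rightarrow> real \<Rightarrow> real \<Rightarrow> real vec \<Rightarrow> (nat \<Rightarrow> real mat) \<Rightarrow> nat \<Rightarrow> real vec" where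
  "shb A b w beta x0 Ss 0 = x0"
| "shb A b w beta x0 Ss (Suc 0) = x0"
| "shb A b w beta x0 Ss (Suc (Suc k)) =
     shb A b w beta x0 Ss (Suc k) - w \<cdot>\<^sub>v gradS A b (Ss (Suc k)) (shb A b w beta x0 Ss (Suc k))
     + beta \<cdot>\<^sub>v (shb A b w beta x0 Ss (Suc k) - shb A b w beta x0 Ss k)"

definition shb_avg :: "nat \<Rightarrow> real mat \<Rightarrow> real vec \<Rightarrow> real \<Rightarrow> real \<Rightarrow> real vec \<Rightarrow> (nat \<Rightarrow> real mat) \<Rightarrow> nat \<Rightarrow> real vec" where
  "shb_avg d A b w beta x0 Ss k = vec d (\<lambda>i. (1 / real k) * (\<Sum>t=1..k. shb A b w beta x0 Ss t $ i))"

end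

theory Submission
  imports Defs "Jordan_Normal_Form.Determinant"
begin

text \<open>Write \<open>g\<^sub>S\<close> for the gradient of \<open>f\<^sub>S\<close>. From \<open>H A A\<^sup>T H = H = H\<^sup>T\<close> one gets \<open>f\<^sub>S x = |g\<^sub>S x|\<^sup>2 / 2\<close> and
  \<open>g\<^sub>S x \<bullet> (x - y) = |g\<^sub>S x|\<^sup>2 - g\<^sub>S x \<bullet> g\<^sub>S y\<close>; these two identities give convexity of \<open>f\<^sub>S\<close> and, since
  \<open>f xs = 0\<close> forces \<open>g\<^sub>S xs = 0\<close> almost surely, \<open>g\<^sub>S x \<bullet> (x - xs) = 2 f\<^sub>S x\<close>. With
  \<open>V\<^sub>n = |(x\<^sub>n\<^sub>+\<^sub>1 - xs) - beta (x\<^sub>n - xs)|\<^sup>2\<close>, a step with sample \<open>S\<close> then satisfies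
  \<open>V\<^sub>n\<^sub>+\<^sub>1 + 2 w (2 - 2 beta - w) f\<^sub>S x\<^sub>n\<^sub>+\<^sub>1 + 2 w beta f\<^sub>S x\<^sub>n\<^sub>+\<^sub>1 \<le> V\<^sub>n + 2 w beta f\<^sub>S x\<^sub>n\<close> almost surely. All terms are
  nonnegative, so this can be integrated in \<open>[0, \<infinity>]\<close> without any integrability of the iterates;
  independence turns \<open>f\<^sub>S\<close> into \<open>f\<close>, the inequality telescopes, and convexity handles the average.\<close>

text \<open>Side conditions on dimensions, unlike carrier membership, contain no extra variables, so
  the simplifier can discharge them in nested products.\<close>

lemma mat_assoc:
  "dim_col A = dim_row B \<Longrightarrow> dim_col B = dim_row C \<Longrightarrow>
    A * B * C = A * (B * (C :: 'a :: semiring_0 mat))"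
  by (rule assoc_mult_mat[of _ "dim_row A" "dim_col A" _ "dim_col B" _ "dim_col C"]) auto

section \<open>Uniqueness of the Moore-Penrose inverse\<close>

text \<open>The body of the definite description in \<open>mp_pinv\<close>, named so that uniqueness
  and existence can be treated separately.\<close>

definition penrose_inverse :: "real mat \<Rightarrow> real mat \<Rightarrow> bool" where
  "penrose_inverse M X \<longleftrightarrow> X \<in> carrier_mat (dim_col M) (dim_row M)
      \<and> M * X * M = M \<and> X * M * X = X
      \<and> transpose_mat (M * X) = M * X \<and> transpose_mat (X * M) = X * M"

text \<open>\<open>M * X\<close> and \<open>M * Y\<close> are both the orthogonal projection onto
  the range of \<open>M\<close>. Each absorbs the other, and transposing a product of symmetric
  matrices reverses it, so they coincide. The same holds for \<open>X * M\<close> and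
  \<open>Y * M\<close>, and then X = XMX = YMY = Y.\<close>

lemma penrose_inverse_unique:
  assumes "penrose_inverse M X" "penrose_inverse M Y"
  shows "X = Y"
proof -
  define r c where "r = dim_row M" and "c = dim_col M"
  have M: "M \<in> carrier_mat r c" and X: "X \<in> carrier_mat c r" and Y: "Y \<in> carrier_mat c r"
    using assms by (auto simp: penrose_inverse_def r_def c_def)
  have x: "M * X * M = M" "X * M * X = X" "(M * X)\<^sup>T = M * X" "(X * M)\<^sup>T = X * M"
    and y: "M * Y * M = M" "Y * M * Y = Y" "(M * Y)\<^sup>T = M * Y" "(Y * M)\<^sup>T = Y * M"
    using assms by (auto simp: penrose_inverse_def)
  note dims = carrier_matD[OF M] carrier_matD[OF X] carrier_matD[OF Y]
  have "M * X = (M * Y * M) * X" by (simp add: y)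
  also have "\<dots> = (M * Y) * (M * X)" by (simp add: mat_assoc dims)
  also have "\<dots> = (M * X * (M * Y))\<^sup>T"
    using M X Y by (subst transpose_mult[of _ r r _ r]) (auto simp: x y)
  also have "M * X * (M * Y) = (M * X * M) * Y" by (simp add: mat_assoc dims)
  also have "(M * X * M * Y)\<^sup>T = M * Y" by (simp add: x y)
  finally have 1: "M * X = M * Y" .
  have "X * M = X * (M * Y * M)" by (simp add: y)
  also have "\<dots> = (X * M) * (Y * M)" by (simp add: mat_assoc dims)
  also have "\<dots> = (Y * M * (X * M))\<^sup>T"
    using M X Y by (subst transpose_mult[of _ c c _ c]) (auto simp: x y)
  also have "Y * M * (X * M) = Y * (M * X * M)" by (simp add: mat_assoc dims)
  also have "(Y * (M * X * M))\<^sup>T = Y * M" by (simp add: x y)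
  finally have 2: "X * M = Y * M" .
  have "X = X * M * X" by (simp add: x)
  also have "\<dots> = Y * M * X" by (simp add: 2)
  also have "\<dots> = Y * (M * X)" by (simp add: mat_assoc dims)
  also have "\<dots> = Y * M * Y" by (simp add: mat_assoc dims 1)
  finally show ?thesis by (simp add: y)
qed

section \<open>Annihilating polynomial of a square matrix\<close>

text \<open>The value at \<open>M\<close> of the polynomial with coefficient list \<open>cs\<close>,
  constant coefficient first. The Horner form lets list induction peel off the lowest
  coefficient.\<close>

fun mat_horner :: "nat \<Rightarrow> real mat \<Rightarrow> real list \<Rightarrow> real mat" where
  "mat_horner n M [] = 0\<^sub>m n n"
| "mat_horner n M (c # cs) = c \<cdot>\<^sub>m 1\<^sub>m n + mat_horner n M cs * M"

lemma mat_horner_carrier: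
  "M \<in> carrier_mat n n \<Longrightarrow> mat_horner n M cs \<in> carrier_mat n n"
  by (induction cs) auto

lemma mat_horner_commute:
  assumes M: "M \<in> carrier_mat n n"
  shows "M * mat_horner n M cs = mat_horner n M cs * M"
proof (induction cs)
  case (Cons c cs)
  let ?E = "mat_horner n M cs"
  have E: "?E \<in> carrier_mat n n" using M by (rule mat_horner_carrier)
  have "M * (c \<cdot>\<^sub>m 1\<^sub>m n + ?E * M) = M * (c \<cdot>\<^sub>m 1\<^sub>m n) + M * (?E * M)"
    by (rule mult_add_distrib_mat[of _ n n _ n]) (use M E in auto)
  also have "\<dots> = c \<cdot>\<^sub>m 1\<^sub>m n * M + ?E * M * M"
    using M E Cons.IH
    by (simp add: mult_smult_distrib[OF M one_carrier_mat] mult_smult_assoc_mat[OF one_carrier_mat M]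
        flip: assoc_mult_mat[OF M E M])
  also have "\<dots> = (c \<cdot>\<^sub>m 1\<^sub>m n + ?E * M) * M"
    by (rule add_mult_distrib_mat[of _ n n _ _ n, symmetric]) (use M E in auto)
  finally show ?case by simp
qed (use M in auto)

lemma mat_horner_transpose:
  assumes M: "M \<in> carrier_mat n n" and sym: "M\<^sup>T = M"
  shows "(mat_horner n M cs)\<^sup>T = mat_horner n M cs"
proof (induction cs)
  case (Cons c cs)
  let ?E = "mat_horner n M cs"
  have E: "?E \<in> carrier_mat n n" using M by (rule mat_horner_carrier)
  have "(c \<cdot>\<^sub>m 1\<^sub>m n + ?E * M)\<^sup>T = (c \<cdot>\<^sub>m 1\<^sub>m n)\<^sup>T + (?E * M)\<^sup>T"
    by (rule transpose_add[of _ n n]) (use M E in auto)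
  also have "(?E * M)\<^sup>T = ?E * M"
    by (subst transpose_mult[OF E M]) (simp add: sym Cons.IH mat_horner_commute[OF M])
  also have "(c \<cdot>\<^sub>m 1\<^sub>m n :: real mat)\<^sup>T = c \<cdot>\<^sub>m 1\<^sub>m n"
    by (auto intro!: eq_matI)
  finally show ?case by simp
qed auto

lemma mat_horner_index:
  assumes M: "M \<in> carrier_mat n n" and i: "i < n" and j: "j < n"
  shows "mat_horner n M cs $$ (i, j) = (\<Sum>k<length cs. cs ! k * (M ^\<^sub>m k) $$ (i, j))"
  using j
proof (induction cs arbitrary: j)
  case (Cons c cs)
  let ?E = "mat_horner n M cs"
  have E: "?E \<in> carrier_mat n n" using M by (rule mat_horner_carrier)
  have P: "M ^\<^sub>m k \<in> carrier_mat n n" for k using M by simp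
  have "(?E * M) $$ (i, j) = (\<Sum>l<n. ?E $$ (i, l) * M $$ (l, j))"
    using E M i Cons.prems by (auto simp: scalar_prod_def atLeast0LessThan)
  also have "\<dots> = (\<Sum>l<n. \<Sum>k<length cs. cs ! k * ((M ^\<^sub>m k) $$ (i, l) * M $$ (l, j)))"
    by (simp add: Cons.IH sum_distrib_right mult.assoc)
  also have "\<dots> = (\<Sum>k<length cs. cs ! k * (\<Sum>l<n. (M ^\<^sub>m k) $$ (i, l) * M $$ (l, j)))"
    by (subst sum.swap) (simp add: sum_distrib_left)
  also have "\<dots> = (\<Sum>k<length cs. cs ! k * (M ^\<^sub>m Suc k) $$ (i, j))"
    using M i Cons.prems P by (auto simp: scalar_prod_def atLeast0LessThan intro!: sum.cong)
  finally have "(?E * M) $$ (i, j) = \<dots>" .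
  moreover have "(c \<cdot>\<^sub>m 1\<^sub>m n + ?E * M) $$ (i, j) = c * 1\<^sub>m n $$ (i, j) + (?E * M) $$ (i, j)"
    using E M i Cons.prems by simp
  ultimately show ?case using M by (simp add: sum.lessThan_Suc_shift del: sum.lessThan_Suc)
qed (use i in auto)

text \<open>The \<open>n * n + 1\<close> powers of \<open>M\<close> from degree 0 to
  \<open>n * n\<close> lie in a space of dimension \<open>n * n\<close>, hence are linearly
  dependent.\<close>

lemma mat_horner_annihilates:
  assumes M: "M \<in> carrier_mat n n"
  shows "\<exists>cs. mat_horner n M cs = 0\<^sub>m n n \<and> (\<exists>c\<in>set cs. c \<noteq> 0)"
proof -
  define N where "N = Suc (n * n)"
  \<comment> \<open>Column \<open>k\<close> is the \<open>k\<close>-th power of \<open>M\<close>,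
    flattened row by row. One zero row is appended to make \<open>B\<close> square, so that the
    determinant criterion for a nontrivial kernel applies.\<close>
  define B where "B = mat N N (\<lambda>(r, k). if r < n * n then (M ^\<^sub>m k) $$ (r div n, r mod n) else 0)"
  have B: "B \<in> carrier_mat N N" by (simp add: B_def)
  \<comment> \<open>The appended zero row is a zero column of the transpose, which therefore kills a
    unit vector and is singular.\<close>
  have "B\<^sup>T *\<^sub>v unit_vec N (n * n) = 0\<^sub>v N"
    by (rule eq_vecI) (auto simp: B_def N_def)
  moreover have "unit_vec N (n * n) \<noteq> (0\<^sub>v N :: real vec)"
    by (auto simp: N_def dest!: arg_cong[of _ _ "\<lambda>v. v $ (n * n)"])
  ultimately have "det (B\<^sup>T) = 0"
    using B by (subst det_0_iff_vec_prod_zero_field[of _ N]) (auto intro!: exI[of _ "unit_vec N (n * n)"])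
  then have "det B = 0" using det_transpose[OF B] by simp
  then obtain v where v: "v \<in> carrier_vec N" "v \<noteq> 0\<^sub>v N" "B *\<^sub>v v = 0\<^sub>v N"
    using det_0_iff_vec_prod_zero_field[OF B] by blast
  define cs where "cs = list_of_vec v"
  have len: "length cs = N" and nth: "\<And>k. k < N \<Longrightarrow> cs ! k = v $ k"
    using v(1) by (auto simp: cs_def list_of_vec_index)
  have "mat_horner n M cs $$ (i, j) = 0" if ij: "i < n" "j < n" for i j
  proof -
    define r where "r = i * n + j"
    have r: "r < n * n" "r div n = i" "r mod n = j"
    proof -
      have "r < Suc i * n" using ij by (simp add: r_def)
      also have "\<dots> \<le> n * n" using ij by (intro mult_le_mono1) auto
      finally show "r < n * n" .
    qed (use ij in \<open>auto simp: r_def\<close>)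
    have "mat_horner n M cs $$ (i, j) = (\<Sum>k<N. (M ^\<^sub>m k) $$ (i, j) * v $ k)"
      by (auto simp: mat_horner_index[OF M ij] len nth mult.commute intro!: sum.cong)
    also have "\<dots> = (B *\<^sub>v v) $ r"
      using r v(1) by (auto simp: B_def N_def scalar_prod_def atLeast0LessThan)
    finally show ?thesis using v(3) r by (simp add: N_def)
  qed
  then have "mat_horner n M cs = 0\<^sub>m n n"
    using mat_horner_carrier[OF M, of cs] by (intro eq_matI) auto
  moreover from v obtain k where "k < N" "v $ k \<noteq> 0"
    by (metis carrier_vecD eq_vecI index_zero_vec)
  then have "\<exists>c\<in>set cs. c \<noteq> 0" using len nth by (metis nth_mem)
  ultimately show ?thesis by blast
qed

section \<open>Existence of the pseudoinverse of a symmetric matrix\<close>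

text \<open>For a column y of \<open>Y\<close>, symmetry gives |My|^2 = y . M(My) = 0.\<close>

lemma symmetric_mult_mult_eq_0:
  fixes M Y :: "real mat"
  assumes M: "M \<in> carrier_mat n n" and sym: "M\<^sup>T = M" and Y: "Y \<in> carrier_mat n p"
    and 0: "M * (M * Y) = 0\<^sub>m n p"
  shows "M * Y = 0\<^sub>m n p"
proof (rule eq_matI)
  fix i j assume "i < dim_row (0\<^sub>m n p :: real mat)" "j < dim_col (0\<^sub>m n p :: real mat)"
  then have ij: "i < n" "j < p" by auto
  define u where "u = col (M * Y) j"
  have y: "col Y j \<in> carrier_vec n" using Y by (simp add: carrier_vecI)
  have u: "u = M *\<^sub>v col Y j" "u \<in> carrier_vec n"
    using M Y ij by (auto simp: u_def col_mult2[OF M Y])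
  have "M *\<^sub>v u = col (M * (M * Y)) j"
    unfolding u_def using ij by (intro col_mult2[OF M mult_carrier_mat[OF M Y], symmetric])
  then have Mu: "M *\<^sub>v u = 0\<^sub>v n" using ij by (auto simp: 0 intro!: eq_vecI)
  have "u \<bullet> u = (M\<^sup>T *\<^sub>v col Y j) \<bullet> u" by (simp add: u sym)
  also have "\<dots> = col Y j \<bullet> (M *\<^sub>v u)"
    using transpose_vec_mult_scalar[OF M u(2) y] by simp
  also have "\<dots> = 0" using y by (simp add: Mu)
  finally have "(\<Sum>l<n. u $ l * u $ l) = 0"
    using u(2) by (simp add: scalar_prod_def atLeast0LessThan)
  then have "u $ i = 0" using ij by (subst (asm) sum_nonneg_eq_0_iff) auto
  moreover have "u $ i = (M * Y) $$ (i, j)"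
    using ij M Y by (simp add: u_def)
  ultimately show "(M * Y) $$ (i, j) = 0\<^sub>m n p $$ (i, j)" using ij by simp
qed (use M Y in auto)

text \<open>Since a symmetric matrix and its square have the same kernel, the lowest nonzero coefficient
  of an annihilating polynomial may be moved down to degree one.\<close>

lemma symmetric_group_inverse:
  fixes M :: "real mat"
  assumes M: "M \<in> carrier_mat n n" and sym: "M\<^sup>T = M"
  shows "\<exists>P \<in> carrier_mat n n. P\<^sup>T = P \<and> P * M = M * P \<and> M * M * P = M"
proof -
  \<comment> \<open>Assuming M p(M) = 0 instead of p(M) = 0 makes the induction work: if p = t q,
    then M (M q(M)) = 0, and the kernel argument reduces this to M q(M) = 0.\<close>
  have "\<exists>P \<in> carrier_mat n n. P\<^sup>T = P \<and> P * M = M * P \<and> M * M * P = M"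
    if "M * mat_horner n M cs = 0\<^sub>m n n" "\<exists>c\<in>set cs. c \<noteq> 0" for cs
    using that
  proof (induction cs)
    case (Cons c cs)
    let ?E = "mat_horner n M cs"
    have E: "?E \<in> carrier_mat n n" using M by (rule mat_horner_carrier)
    note comm = mat_horner_commute[OF M, of cs, symmetric]
    have "0\<^sub>m n n = M * (c \<cdot>\<^sub>m 1\<^sub>m n + ?E * M)" using Cons.prems by simp
    also have "\<dots> = M * (c \<cdot>\<^sub>m 1\<^sub>m n) + M * (?E * M)"
      by (rule mult_add_distrib_mat[of _ n n _ n]) (use M E in auto)
    also have "\<dots> = c \<cdot>\<^sub>m M + M * (M * ?E)" using M E
      by (simp add: comm mult_smult_distrib[OF M one_carrier_mat])
    finally have eq: "c \<cdot>\<^sub>m M + M * (M * ?E) = 0\<^sub>m n n" ..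
    show ?case
    proof (cases "c = 0")
      case True
      have "0 \<cdot>\<^sub>m M = 0\<^sub>m n n" using M by (auto intro!: eq_matI)
      then have "M * (M * ?E) = 0\<^sub>m n n" using eq True M E by simp
      then have "M * ?E = 0\<^sub>m n n" by (rule symmetric_mult_mult_eq_0[OF M sym E])
      then show ?thesis using Cons True by auto
    next
      case False
      \<comment> \<open>Now \<open>eq\<close> can be solved for \<open>M\<close>: dividing by the
        nonzero \<open>c\<close> gives M = M M (-E/c). As a polynomial in \<open>M\<close>, this
        \<open>P\<close> is symmetric and commutes with \<open>M\<close>.\<close>
      define P where "P = (- 1 / c) \<cdot>\<^sub>m ?E"
      have P: "P \<in> carrier_mat n n" using E by (simp add: P_def)
      have "P\<^sup>T = (- 1 / c) \<cdot>\<^sub>m ?E\<^sup>T" by (auto simp: P_def)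
      then have "P\<^sup>T = P" by (simp add: P_def mat_horner_transpose[OF M sym])
      moreover have "P * M = M * P"
        using M E by (simp add: P_def comm mult_smult_distrib mult_smult_assoc_mat)
      moreover have "M * M * P = M"
      proof -
        have "M * M * P = (- 1 / c) \<cdot>\<^sub>m (M * M * ?E)"
          unfolding P_def by (rule mult_smult_distrib[OF mult_carrier_mat[OF M M] E])
        also have "M * M * ?E = M * (M * ?E)" using M E by simp
        also have "(- 1 / c) \<cdot>\<^sub>m (M * (M * ?E)) = M"
        proof (rule eq_matI)
          fix i j assume ij: "i < dim_row M" "j < dim_col M"
          have "(c \<cdot>\<^sub>m M + M * (M * ?E)) $$ (i, j) = 0" using eq ij M by simp
          then have "c * M $$ (i, j) + (M * (M * ?E)) $$ (i, j) = 0" using ij M E by simp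
          then have "(M * (M * ?E)) $$ (i, j) = - (c * M $$ (i, j))" by linarith
          then show "((- 1 / c) \<cdot>\<^sub>m (M * (M * ?E))) $$ (i, j) = M $$ (i, j)"
            using ij M E False by simp
        qed (use M E in auto)
        finally show ?thesis .
      qed
      ultimately show ?thesis using P by blast
    qed
  qed auto
  moreover obtain cs where "mat_horner n M cs = 0\<^sub>m n n" "\<exists>c\<in>set cs. c \<noteq> 0"
    using mat_horner_annihilates[OF M] by blast
  ultimately show ?thesis using M by (metis right_mult_zero_mat)
qed

text \<open>\<open>M * P\<close> is the orthogonal projection onto the range of \<open>M\<close>,
  but \<open>P\<close> may be nonzero on the kernel of \<open>M\<close>. The product P M P still
  inverts \<open>M\<close> on its range and vanishes on the kernel.\<close>

lemma symmetric_penrose_inverse: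
  assumes M: "M \<in> carrier_mat n n" and sym: "M\<^sup>T = M"
  shows "\<exists>X. penrose_inverse M X \<and> X\<^sup>T = X"
proof -
  obtain P where P: "P \<in> carrier_mat n n" "P\<^sup>T = P" "P * M = M * P" "M * M * P = M"
    using symmetric_group_inverse[OF M sym] by blast
  define X where "X = P * (M * P)"
  have X: "X \<in> carrier_mat n n"
    unfolding X_def by (rule mult_carrier_mat[OF P(1) mult_carrier_mat[OF M P(1)]])
  note dims = carrier_matD[OF M] carrier_matD[OF P(1)] carrier_matD[OF X]
  have MMP: "M * (M * P) = M" using P(4) by (simp add: mat_assoc dims)
  have XM: "X * M = M * P"
  proof -
    have "X * M = P * (M * (P * M))" by (simp add: X_def mat_assoc dims)
    then show ?thesis by (simp add: P(3) MMP)
  qed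
  have MX: "M * X = M * P"
  proof -
    have "M * X = (M * P) * (M * P)" by (simp add: X_def mat_assoc dims)
    also have "\<dots> = P * (M * (M * P))" by (simp add: mat_assoc dims flip: P(3))
    finally show ?thesis by (simp add: MMP P(3))
  qed
  have MPT: "(M * P)\<^sup>T = M * P" using M P sym by (simp add: transpose_mult[OF M P(1)])
  have XT: "X\<^sup>T = X"
  proof -
    have "X\<^sup>T = (M * P) * P" using M P MPT by (simp add: X_def transpose_mult[of P n n "M * P" n])
    also have "\<dots> = X" using M P by (simp add: X_def flip: P(3))
    finally show ?thesis .
  qed
  have "M * X * M = M"
  proof -
    have "M * X * M = M * (P * M)" by (simp add: MX mat_assoc dims)
    then show ?thesis by (simp add: P(3) MMP)
  qed
  moreover have "X * M * X = X"
  proof -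
    have "X * M * X = P * M * X" by (simp only: XM P(3))
    also have "\<dots> = P * (M * X)" by (simp add: mat_assoc dims)
    finally show ?thesis by (simp only: MX flip: X_def)
  qed
  ultimately show ?thesis using X XT MX XM MPT M by (auto simp: penrose_inverse_def)
qed

text \<open>Existence and uniqueness evaluate the definite description, and the symmetric witness
  passes on its symmetry.\<close>

lemma mp_pinv_symmetric:
  assumes "M \<in> carrier_mat n n" and "M\<^sup>T = M"
  shows "penrose_inverse M (mp_pinv M)" and "(mp_pinv M)\<^sup>T = mp_pinv M"
proof -
  obtain X where X: "penrose_inverse M X" "X\<^sup>T = X"
    using symmetric_penrose_inverse[OF assms] by blast
  have "mp_pinv M = (THE X. penrose_inverse M X)"
    by (simp add: mp_pinv_def penrose_inverse_def)
  then have "mp_pinv M = X" using X penrose_inverse_unique by (metis the_equality)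
  then show "penrose_inverse M (mp_pinv M)" and "(mp_pinv M)\<^sup>T = mp_pinv M" using X by auto
qed

section \<open>The matrix H\<close>

text \<open>With \<open>M\<close> the symmetric matrix inside the pseudoinverse and \<open>X\<close>
  its pseudoinverse, H = S X S^T inherits symmetry from \<open>X\<close>, and the last identity is X
  M X = X between S and S^T.\<close>

lemma Hmat_properties:
  assumes A: "A \<in> carrier_mat m d" and S: "dim_row S = m"
  shows "Hmat A S \<in> carrier_mat m m" and "(Hmat A S)\<^sup>T = Hmat A S"
    and "Hmat A S * (A * (A\<^sup>T * Hmat A S)) = Hmat A S"
proof -
  define c where "c = dim_col S"
  define M where "M = S\<^sup>T * A * A\<^sup>T * S"
  define X where "X = mp_pinv M"
  have S': "S \<in> carrier_mat m c" using S by (auto simp: c_def)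
  have M: "M \<in> carrier_mat c c" using carrier_matD[OF S'] by (intro carrier_matI) (simp_all add: M_def)
  note dims = carrier_matD[OF S'] carrier_matD[OF A]
  have "M\<^sup>T = S\<^sup>T * (S\<^sup>T * A * A\<^sup>T)\<^sup>T"
    unfolding M_def using S' A by (intro transpose_mult[of _ c m]) auto
  also have "(S\<^sup>T * A * A\<^sup>T)\<^sup>T = A\<^sup>T\<^sup>T * (S\<^sup>T * A)\<^sup>T"
    using S' A by (intro transpose_mult[of _ c d]) auto
  also have "(S\<^sup>T * A)\<^sup>T = A\<^sup>T * S\<^sup>T\<^sup>T"
    using S' A by (intro transpose_mult[of _ c m]) auto
  finally have "M\<^sup>T = M"
    by (simp add: M_def mat_assoc dims)
  from mp_pinv_symmetric[OF M this]
  have X: "X \<in> carrier_mat c c" "X * M * X = X" "X\<^sup>T = X"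
    using M by (auto simp: X_def penrose_inverse_def)
  have H: "Hmat A S = S * (X * S\<^sup>T)"
    using carrier_matD[OF X(1)] unfolding Hmat_def M_def[symmetric] X_def[symmetric]
    by (simp add: mat_assoc dims)
  show "Hmat A S \<in> carrier_mat m m" using carrier_matD[OF S'] by (intro carrier_matI) (simp_all add: H)
  have "(Hmat A S)\<^sup>T = (X * S\<^sup>T)\<^sup>T * S\<^sup>T"
    unfolding H using S' X by (intro transpose_mult[of _ m c]) auto
  also have "(X * S\<^sup>T)\<^sup>T = S\<^sup>T\<^sup>T * X\<^sup>T"
    using S' X by (intro transpose_mult[of _ c c]) auto
  finally show "(Hmat A S)\<^sup>T = Hmat A S"
    using carrier_matD[OF X(1)] by (simp add: H X(3) mat_assoc dims)
  have "Hmat A S * (A * (A\<^sup>T * Hmat A S)) = S * (X * M * X * S\<^sup>T)"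
    using carrier_matD[OF X(1)] by (simp add: H M_def mat_assoc dims)
  then show "Hmat A S * (A * (A\<^sup>T * Hmat A S)) = Hmat A S"
    by (simp add: X H)
qed

lemma scalar_prod_self_nonneg: "0 \<le> v \<bullet> (v :: real vec)"
  by (auto simp: scalar_prod_def intro!: sum_nonneg)

lemma scalar_prod_self_eq_0:
  fixes v :: "real vec"
  assumes "v \<in> carrier_vec n" "v \<bullet> v = 0"
  shows "v = 0\<^sub>v n"
  using assms by (intro eq_vecI) (auto simp: scalar_prod_def sum_nonneg_eq_0_iff)

lemma scalar_prod_le_half_squares:
  fixes u v :: "real vec"
  assumes "u \<in> carrier_vec n" "v \<in> carrier_vec n"
  shows "u \<bullet> v \<le> (1/2) * (u \<bullet> u) + (1/2) * (v \<bullet> v)"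
proof -
  have "u $ i * v $ i \<le> (1/2) * (u $ i * u $ i) + (1/2) * (v $ i * v $ i)" for i
    using sum_squares_ge_zero[of "u $ i - v $ i" 0] by (simp add: algebra_simps)
  then have "(\<Sum>i<n. u $ i * v $ i)
      \<le> (\<Sum>i<n. (1/2) * (u $ i * u $ i) + (1/2) * (v $ i * v $ i))"
    by (intro sum_mono)
  then show ?thesis using assms
    by (simp add: scalar_prod_def atLeast0LessThan sum.distrib sum_divide_distrib)
qed

lemma residual_carrier:
  fixes A :: "real mat"
  shows "A \<in> carrier_mat m d \<Longrightarrow> b \<in> carrier_vec m \<Longrightarrow> x \<in> carrier_vec d \<Longrightarrow>
    A *\<^sub>v x - b \<in> carrier_vec m"
  by auto

section \<open>Gradient identities and the heavy ball step for a fixed sample\<close>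

context
  fixes A S :: "real mat" and b :: "real vec" and m d :: nat
  assumes A: "A \<in> carrier_mat m d" and b: "b \<in> carrier_vec m" and S: "dim_row S = m"
begin

lemma gradS_carrier [simp]: "gradS A b S x \<in> carrier_vec d"
  using A by (simp add: gradS_def carrier_vecI)

text \<open>Both parts move \<open>Hmat A S\<close> across the scalar product by symmetry; the first
  then contracts H A A^T H to H.\<close>

lemma Hmat_scalar_prod:
  fixes r s :: "real vec"
  assumes r: "r \<in> carrier_vec m" and s: "s \<in> carrier_vec m"
  shows "(A\<^sup>T *\<^sub>v (Hmat A S *\<^sub>v r)) \<bullet> (A\<^sup>T *\<^sub>v (Hmat A S *\<^sub>v s)) = r \<bullet> (Hmat A S *\<^sub>v s)"
    and "(Hmat A S *\<^sub>v r) \<bullet> s = r \<bullet> (Hmat A S *\<^sub>v s)"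
proof -
  let ?H = "Hmat A S"
  note H = Hmat_properties[OF A S]
  have Hr: "?H *\<^sub>v r \<in> carrier_vec m" and Hs: "?H *\<^sub>v s \<in> carrier_vec m"
    using H(1) r s by auto
  have AT: "A\<^sup>T \<in> carrier_mat d m" using A by simp
  have v: "A\<^sup>T *\<^sub>v (?H *\<^sub>v s) \<in> carrier_vec d"
    using AT Hs by auto
  have sym: "(?H *\<^sub>v r) \<bullet> t = r \<bullet> (?H *\<^sub>v t)" if "t \<in> carrier_vec m" for t
    using transpose_vec_mult_scalar[OF H(1) that r] by (simp add: H(2))
  show "(?H *\<^sub>v r) \<bullet> s = r \<bullet> (?H *\<^sub>v s)" by (rule sym[OF s])
  have "(A\<^sup>T *\<^sub>v (?H *\<^sub>v r)) \<bullet> (A\<^sup>T *\<^sub>v (?H *\<^sub>v s))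
      = (?H *\<^sub>v r) \<bullet> (A *\<^sub>v (A\<^sup>T *\<^sub>v (?H *\<^sub>v s)))"
    by (rule transpose_vec_mult_scalar[OF A v Hr])
  also have "\<dots> = r \<bullet> (?H *\<^sub>v (A *\<^sub>v (A\<^sup>T *\<^sub>v (?H *\<^sub>v s))))"
    using A v by (intro sym) auto
  also have "?H *\<^sub>v (A *\<^sub>v (A\<^sup>T *\<^sub>v (?H *\<^sub>v s))) = (?H * (A * (A\<^sup>T * ?H))) *\<^sub>v s"
  proof -
    have ATH: "A\<^sup>T * ?H \<in> carrier_mat d m" using AT H(1) by (rule mult_carrier_mat)
    show ?thesis
      using assoc_mult_mat_vec[OF H(1) mult_carrier_mat[OF A ATH] s]
        assoc_mult_mat_vec[OF A ATH s] assoc_mult_mat_vec[OF AT H(1) s] by simp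
  qed
  finally show "(A\<^sup>T *\<^sub>v (?H *\<^sub>v r)) \<bullet> (A\<^sup>T *\<^sub>v (?H *\<^sub>v s)) = r \<bullet> (?H *\<^sub>v s)"
    by (simp add: H(3))
qed

lemma fS_eq_gradS:
  assumes "x \<in> carrier_vec d"
  shows "fS A b S x = (1/2) * (gradS A b S x \<bullet> gradS A b S x)"
  using Hmat_scalar_prod(1)[OF residual_carrier[OF A b assms] residual_carrier[OF A b assms]]
  by (simp add: fS_def gradS_def)

lemma fS_nonneg: "x \<in> carrier_vec d \<Longrightarrow> 0 \<le> fS A b S x"
  using scalar_prod_self_nonneg by (simp add: fS_eq_gradS)

text \<open>A(x - y) is a difference of residuals, since \<open>b\<close> cancels; both resulting
  forms in H are scalar products of gradients.\<close>

lemma gradS_scalar_prod_diff: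
  assumes x: "x \<in> carrier_vec d" and y: "y \<in> carrier_vec d"
  shows "gradS A b S x \<bullet> (x - y)
    = gradS A b S x \<bullet> gradS A b S x - gradS A b S x \<bullet> gradS A b S y"
proof -
  let ?H = "Hmat A S" and ?r = "\<lambda>x. A *\<^sub>v x - b"
  note H = Hmat_properties[OF A S]
  have r: "?r x \<in> carrier_vec m" "?r y \<in> carrier_vec m"
    using x y by (auto intro: residual_carrier[OF A b])
  have Ad: "A *\<^sub>v (x - y) = ?r x - ?r y"
    using A b x y by (subst mult_minus_distrib_mat_vec[OF A x y]) (auto intro!: eq_vecI)
  have "gradS A b S x \<bullet> (x - y) = (?H *\<^sub>v ?r x) \<bullet> (A *\<^sub>v (x - y))"
    unfolding gradS_def
    by (rule transpose_vec_mult_scalar[OF A]) (use x y r H(1) in auto)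
  also have "\<dots> = (?H *\<^sub>v ?r x) \<bullet> ?r x - (?H *\<^sub>v ?r x) \<bullet> ?r y"
    unfolding Ad by (rule scalar_prod_minus_distrib[of _ m]) (use r H(1) in auto)
  finally show ?thesis
    using Hmat_scalar_prod r by (simp add: gradS_def)
qed

text \<open>With g and h the gradients at \<open>x\<close> and \<open>y\<close>, this reduces to g .
  h <= |g|^2/2 + |h|^2/2.\<close>

lemma fS_above_tangent:
  assumes x: "x \<in> carrier_vec d" and y: "y \<in> carrier_vec d"
  shows "fS A b S x - fS A b S y \<le> gradS A b S x \<bullet> (x - y)"
  using scalar_prod_le_half_squares[of "gradS A b S x" d "gradS A b S y"]
  by (simp add: gradS_scalar_prod_diff[OF x y] fS_eq_gradS x y)

text \<open>Jensen's inequality: the tangent inequalities at the average are summed, and their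
  linear terms cancel.\<close>

lemma fS_average:
  assumes X: "\<And>t. X t \<in> carrier_vec d" and k: "k \<ge> 1"
  shows "real k * fS A b S (vec d (\<lambda>i. (1 / real k) * (\<Sum>t=1..k. X t $ i)))
    \<le> (\<Sum>t=1..k. fS A b S (X t))"
proof -
  define a where "a = vec d (\<lambda>i. (1 / real k) * (\<Sum>t=1..k. X t $ i))"
  define g where "g = gradS A b S a"
  have a: "a \<in> carrier_vec d" and g: "g \<in> carrier_vec d" by (simp_all add: a_def g_def)
  have "(\<Sum>t=1..k. g \<bullet> (a - X t)) = (\<Sum>i<d. \<Sum>t=1..k. g $ i * (a $ i - X t $ i))"
    using a by (subst sum.swap) (simp add: carrier_vecD[OF X] scalar_prod_def atLeast0LessThan)
  also have "\<dots> = (\<Sum>i<d. g $ i * (real k * a $ i - (\<Sum>t=1..k. X t $ i)))"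
    by (simp add: sum_subtractf flip: sum_distrib_left)
  also have "\<dots> = 0" using k by (simp add: a_def)
  finally have "(\<Sum>t=1..k. fS A b S a - fS A b S (X t)) \<le> 0"
    using sum_mono[of "{1..k}" "\<lambda>t. fS A b S a - fS A b S (X t)" "\<lambda>t. g \<bullet> (a - X t)"]
      fS_above_tangent[OF a X] by (simp add: g_def)
  then show ?thesis by (simp add: sum_subtractf a_def)
qed

lemma heavy_ball_step:
  fixes x y z x' u u' :: "real vec"
  assumes x: "x \<in> carrier_vec d" and y: "y \<in> carrier_vec d" and z: "z \<in> carrier_vec d"
    and z0: "fS A b S z = 0" and w: "0 \<le> w" and beta: "0 \<le> beta"
    and u: "u = (x - z) - beta \<cdot>\<^sub>v (y - z)"
    and x': "x' = x - w \<cdot>\<^sub>v gradS A b S x + beta \<cdot>\<^sub>v (x - y)"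
    and u': "u' = (x' - z) - beta \<cdot>\<^sub>v (x - z)"
  shows "u' \<bullet> u' + 2 * w * (2 - 2 * beta - w) * fS A b S x + 2 * w * beta * fS A b S x
    \<le> u \<bullet> u + 2 * w * beta * fS A b S y"
proof -
  define g where "g = gradS A b S x"
  have g: "g \<in> carrier_vec d" by (simp add: g_def)
  have uc: "u \<in> carrier_vec d" using x y z by (auto simp: u)
  \<comment> \<open>A zero value is a zero squared gradient norm, so the cross term in
    \<open>gradS_scalar_prod_diff\<close> disappears.\<close>
  have "gradS A b S z = 0\<^sub>v d"
    using z z0 by (intro scalar_prod_self_eq_0) (auto simp: fS_eq_gradS)
  then have gz: "g \<bullet> (x - z) = 2 * fS A b S x"
    using gradS_scalar_prod_diff[OF x z] g x by (simp add: g_def fS_eq_gradS)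
  have gy: "fS A b S x - fS A b S y \<le> g \<bullet> (x - y)"
    unfolding g_def by (rule fS_above_tangent[OF x y])
  \<comment> \<open>This splitting reduces \<open>g \<bullet> u\<close> to one scalar product known
    exactly (\<open>gz\<close>) and one bounded by convexity (\<open>gy\<close>).\<close>
  have "u = (1 - beta) \<cdot>\<^sub>v (x - z) + beta \<cdot>\<^sub>v (x - y)"
    using x y z by (auto simp: u algebra_simps intro!: eq_vecI)
  then have gu: "g \<bullet> u = (1 - beta) * (g \<bullet> (x - z)) + beta * (g \<bullet> (x - y))"
    using x y z g by (simp add: scalar_prod_add_distrib[of _ d])
  \<comment> \<open>The momentum in \<open>x'\<close> cancels against the correction terms, leaving
    a plain gradient step.\<close>
  have "u' = u - w \<cdot>\<^sub>v g"
    using x y z g by (auto simp: u u' x' g_def[symmetric] algebra_simps intro!: eq_vecI)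
  then have "u' \<bullet> u' = (\<Sum>i<d. (u $ i - w * g $ i)\<^sup>2)"
    using uc g by (simp add: scalar_prod_def atLeast0LessThan power2_eq_square)
  also have "\<dots> = (\<Sum>i<d. u $ i * u $ i - 2 * w * (g $ i * u $ i) + w\<^sup>2 * (g $ i * g $ i))"
    by (simp add: power2_eq_square algebra_simps)
  also have "\<dots> = u \<bullet> u - 2 * w * (g \<bullet> u) + w\<^sup>2 * (g \<bullet> g)"
    using uc g by (simp add: scalar_prod_def atLeast0LessThan sum.distrib sum_subtractf sum_distrib_left)
  finally have "u' \<bullet> u' = u \<bullet> u - 2 * w * (g \<bullet> u) + w\<^sup>2 * (2 * fS A b S x)"
    using x by (simp add: fS_eq_gradS g_def)
  moreover have "2 * w * (g \<bullet> u)
      \<ge> 2 * w * ((1 - beta) * (2 * fS A b S x) + beta * (fS A b S x - fS A b S y))"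
    unfolding gu gz using w beta gy by (intro mult_left_mono add_left_mono) auto
  ultimately show ?thesis by (simp add: algebra_simps power2_eq_square)
qed

end

section \<open>Resampling one coordinate\<close>

text \<open>Replacing coordinate \<open>j\<close> by an independent draw from \<open>D\<close>
  preserves the product measure; Tonelli then integrates the fresh draw first.\<close>

lemma nn_integral_PiM_UNIV_split:
  assumes D: "prob_space D" and f: "f \<in> borel_measurable (\<Pi>\<^sub>M i\<in>UNIV. D)"
  shows "(\<integral>\<^sup>+ X. f X \<partial>(\<Pi>\<^sub>M i\<in>UNIV. D))
    = (\<integral>\<^sup>+ X. \<integral>\<^sup>+ s. f (X(j := s)) \<partial>D \<partial>(\<Pi>\<^sub>M i\<in>UNIV. D))"
proof -
  let ?N = "\<Pi>\<^sub>M i\<in>(UNIV :: 'b set). D"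
  interpret D: prob_space D by fact
  interpret N: prob_space ?N by (intro prob_space_PiM D)
  interpret DN: pair_sigma_finite D ?N ..
  have upd: "(\<lambda>(s, X). X(j := s)) \<in> D \<Otimes>\<^sub>M ?N \<rightarrow>\<^sub>M ?N"
    using measurable_compose[OF measurable_pair_swap' measurable_add_dim[of j UNIV "\<lambda>_. D"]]
    by (simp add: split_beta')
  have "distr (D \<Otimes>\<^sub>M ?N) ?N (\<lambda>(s, X). X(j := s)) = ?N"
    using distr_pair_PiM_eq_PiM[of UNIV "\<lambda>_. D" j] D by simp
  then have "(\<integral>\<^sup>+ X. f X \<partial>?N) = (\<integral>\<^sup>+ X. f X \<partial>distr (D \<Otimes>\<^sub>M ?N) ?N (\<lambda>(s, X). X(j := s)))"
    by simp
  also have "\<dots> = (\<integral>\<^sup>+ (s, X). f (X(j := s)) \<partial>(D \<Otimes>\<^sub>M ?N))"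
    by (subst nn_integral_distr[OF upd]) (use f in \<open>simp_all add: split_beta'\<close>)
  also have "\<dots> = (\<integral>\<^sup>+ X. \<integral>\<^sup>+ s. f (X(j := s)) \<partial>D \<partial>?N)"
    using measurable_compose[OF upd f]
    by (subst DN.nn_integral_snd[symmetric]) (simp_all add: split_beta')
  finally show ?thesis .
qed

text \<open>Adaptedness: the recursion producing iterate \<open>Suc (Suc k)\<close> reads sample
  \<open>Suc k\<close>, so iterate \<open>t\<close> is unaffected by resampling any index from
  \<open>t\<close> on.\<close>

lemma shb_cong:
  assumes "\<And>i. 1 \<le> i \<Longrightarrow> i < t \<Longrightarrow> Ss i = Ss' i"
  shows "shb A b w beta x0 Ss t = shb A b w beta x0 Ss' t"
  using assms by (induction A b w beta x0 Ss t rule: shb.induct) auto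

section \<open>The expected function: integrability, convexity, measurability\<close>

context
  fixes A :: "real mat" and b :: "real vec" and D :: "real mat measure" and m d :: nat
  assumes A: "A \<in> carrier_mat m d" and b: "b \<in> carrier_vec m"
    and D: "prob_space D"
    and rows: "\<forall>S \<in> space D. dim_row S = m"
    and EH: "\<forall>i<m. \<forall>j<m. integrable D (\<lambda>S. Hmat A S $$ (i, j))"
begin

lemma residual_index:
  "x \<in> carrier_vec d \<Longrightarrow> i < m \<Longrightarrow> (A *\<^sub>v x - b) $ i = (\<Sum>l<d. A $$ (i, l) * x $ l) - b $ i"
  using A b by (simp add: scalar_prod_def atLeast0LessThan)

lemma Hmat_mult_index:
  assumes S: "S \<in> space D" and x: "x \<in> carrier_vec d" and i: "i < m"
  shows "(Hmat A S *\<^sub>v (A *\<^sub>v x - b)) $ i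
    = (\<Sum>j<m. Hmat A S $$ (i, j) * ((\<Sum>l<d. A $$ (j, l) * x $ l) - b $ j))"
proof -
  have H: "Hmat A S \<in> carrier_mat m m" using Hmat_properties(1)[OF A] rows S by auto
  have r: "A *\<^sub>v x - b \<in> carrier_vec m" by (rule residual_carrier[OF A b x])
  show ?thesis
    using H r i by (simp add: scalar_prod_def atLeast0LessThan residual_index[OF x, symmetric] del: index_minus_vec)
qed

text \<open>Integrability is assumed for the entries of H, so the function is written as a finite
  combination of these entries; \<open>gradS_index\<close> serves the same purpose for the
  gradient.\<close>

lemma fS_expand:
  assumes S: "S \<in> space D" and x: "x \<in> carrier_vec d"
  shows "fS A b S x = (1/2) * (\<Sum>i<m. \<Sum>j<m. ((\<Sum>l<d. A $$ (i, l) * x $ l) - b $ i)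
    * Hmat A S $$ (i, j) * ((\<Sum>l<d. A $$ (j, l) * x $ l) - b $ j))"
proof -
  have H: "Hmat A S \<in> carrier_mat m m" using Hmat_properties(1)[OF A] rows S by auto
  have "(A *\<^sub>v x - b) \<bullet> (Hmat A S *\<^sub>v (A *\<^sub>v x - b))
      = (\<Sum>i<m. (A *\<^sub>v x - b) $ i * (Hmat A S *\<^sub>v (A *\<^sub>v x - b)) $ i)"
    using H by (simp add: scalar_prod_def atLeast0LessThan)
  also have "\<dots> = (\<Sum>i<m. \<Sum>j<m. ((\<Sum>l<d. A $$ (i, l) * x $ l) - b $ i)
      * Hmat A S $$ (i, j) * ((\<Sum>l<d. A $$ (j, l) * x $ l) - b $ j))"
    by (intro sum.cong refl)
      (simp only: lessThan_iff Hmat_mult_index[OF S x] residual_index[OF x] sum_distrib_left mult.assoc)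
  finally show ?thesis by (simp add: fS_def)
qed

lemma gradS_index:
  assumes S: "S \<in> space D" and x: "x \<in> carrier_vec d" and i: "i < d"
  shows "gradS A b S x $ i = (\<Sum>k<m. A $$ (k, i) *
    (\<Sum>j<m. Hmat A S $$ (k, j) * ((\<Sum>l<d. A $$ (j, l) * x $ l) - b $ j)))"
proof -
  have H: "Hmat A S \<in> carrier_mat m m" using Hmat_properties(1)[OF A] rows S by auto
  then have "gradS A b S x $ i = (\<Sum>k<m. A $$ (k, i) * (Hmat A S *\<^sub>v (A *\<^sub>v x - b)) $ k)"
    using A i by (simp add: gradS_def scalar_prod_def atLeast0LessThan)
  then show ?thesis by (simp add: Hmat_mult_index[OF S x])
qed

text \<open>Linearity in the entries of H gives integrability and the value of the integral at
  once.\<close>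

lemma has_bochner_integral_fS:
  assumes x: "x \<in> carrier_vec d"
  shows "has_bochner_integral D (\<lambda>S. fS A b S x)
    ((1/2) * (\<Sum>i<m. \<Sum>j<m. ((\<Sum>l<d. A $$ (i, l) * x $ l) - b $ i)
      * (\<integral>S. Hmat A S $$ (i, j) \<partial>D) * ((\<Sum>l<d. A $$ (j, l) * x $ l) - b $ j)))"
  by (subst has_bochner_integral_cong[OF refl fS_expand[OF _ x] refl], assumption)
    (intro has_bochner_integral_mult_right has_bochner_integral_sum has_bochner_integral_mult_left,
      use EH in \<open>simp add: has_bochner_integral_integrable\<close>)

lemma integrable_fS: "x \<in> carrier_vec d \<Longrightarrow> integrable D (\<lambda>S. fS A b S x)"
  using has_bochner_integral_fS by (rule integrable.intros)

lemma fE_expand: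
  assumes x: "x \<in> carrier_vec d"
  shows "fE D A b x = (1/2) * (\<Sum>i<m. \<Sum>j<m. ((\<Sum>l<d. A $$ (i, l) * x $ l) - b $ i)
    * (\<integral>S. Hmat A S $$ (i, j) \<partial>D) * ((\<Sum>l<d. A $$ (j, l) * x $ l) - b $ j))"
  unfolding fE_def by (rule has_bochner_integral_integral_eq[OF has_bochner_integral_fS[OF x]])

lemma fS_space_nonneg: "S \<in> space D \<Longrightarrow> x \<in> carrier_vec d \<Longrightarrow> 0 \<le> fS A b S x"
  using fS_nonneg[OF A b] rows by auto

lemma nn_integral_fS:
  assumes x: "x \<in> carrier_vec d"
  shows "(\<integral>\<^sup>+ S. ennreal (fS A b S x) \<partial>D) = ennreal (fE D A b x)"
  unfolding fE_def using integrable_fS[OF x] fS_space_nonneg[OF _ x]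
  by (intro nn_integral_eq_integral) auto

lemma fE_nonneg: "x \<in> carrier_vec d \<Longrightarrow> 0 \<le> fE D A b x"
  unfolding fE_def using fS_space_nonneg by (intro integral_nonneg_AE) auto

text \<open>A nonnegative integrable function with integral zero vanishes almost everywhere.\<close>

lemma AE_fS_eq_0:
  assumes x: "x \<in> carrier_vec d" and "fE D A b x = 0"
  shows "AE S in D. fS A b S x = 0"
  using assms integral_nonneg_eq_0_iff_AE[OF integrable_fS[OF x]] fS_space_nonneg[OF _ x]
  by (auto simp: fE_def)

lemma fE_average:
  assumes X: "\<And>t. X t \<in> carrier_vec d" and k: "k \<ge> 1"
  shows "real k * fE D A b (vec d (\<lambda>i. (1 / real k) * (\<Sum>t=1..k. X t $ i)))
    \<le> (\<Sum>t=1..k. fE D A b (X t))"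
proof -
  let ?a = "vec d (\<lambda>i. (1 / real k) * (\<Sum>t=1..k. X t $ i))"
  have "(\<integral>S. real k * fS A b S ?a \<partial>D) \<le> (\<integral>S. (\<Sum>t=1..k. fS A b S (X t)) \<partial>D)"
    using integrable_fS X fS_average[OF A b _ X k] rows by (intro integral_mono) auto
  then show ?thesis using integrable_fS X by (simp add: fE_def)
qed

lemma measurable_Hmat:
  assumes "h \<in> N \<rightarrow>\<^sub>M D" "i < m" "j < m"
  shows "(\<lambda>z. Hmat A (h z) $$ (i, j)) \<in> borel_measurable N"
  using measurable_compose[OF assms(1) borel_measurable_integrable] assms(2,3) EH by blast

text \<open>Sample and point both vary with \<open>z\<close>, because on the path space the iterates
  are random too; vectors enter through their coordinates.\<close>

lemma measurable_fS:
  assumes h: "h \<in> N \<rightarrow>\<^sub>M D" and X: "\<And>z. z \<in> space N \<Longrightarrow> X z \<in> carrier_vec d"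
    and mX: "\<And>i. i < d \<Longrightarrow> (\<lambda>z. X z $ i) \<in> borel_measurable N"
  shows "(\<lambda>z. fS A b (h z) (X z)) \<in> borel_measurable N"
proof -
  have eq: "fS A b (h z) (X z) = (1/2) * (\<Sum>i<m. \<Sum>j<m. ((\<Sum>l<d. A $$ (i, l) * X z $ l) - b $ i)
      * Hmat A (h z) $$ (i, j) * ((\<Sum>l<d. A $$ (j, l) * X z $ l) - b $ j))" if "z \<in> space N" for z
    using measurable_space[OF h that] X[OF that] by (rule fS_expand)
  show ?thesis
    by (subst measurable_cong[OF eq], assumption, intro borel_measurable_times borel_measurable_sum
      borel_measurable_diff borel_measurable_const measurable_Hmat[OF h] mX) simp_all
qed

lemma measurable_gradS:
  assumes h: "h \<in> N \<rightarrow>\<^sub>M D" and X: "\<And>z. z \<in> space N \<Longrightarrow> X z \<in> carrier_vec d"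
    and mX: "\<And>i. i < d \<Longrightarrow> (\<lambda>z. X z $ i) \<in> borel_measurable N" and i: "i < d"
  shows "(\<lambda>z. gradS A b (h z) (X z) $ i) \<in> borel_measurable N"
proof -
  have eq: "gradS A b (h z) (X z) $ i = (\<Sum>k<m. A $$ (k, i) *
      (\<Sum>j<m. Hmat A (h z) $$ (k, j) * ((\<Sum>l<d. A $$ (j, l) * X z $ l) - b $ j)))"
    if "z \<in> space N" for z
    using measurable_space[OF h that] X[OF that] i by (rule gradS_index)
  show ?thesis
    by (subst measurable_cong[OF eq], assumption, intro borel_measurable_times borel_measurable_sum
      borel_measurable_diff borel_measurable_const measurable_Hmat[OF h] mX) simp_all
qed

lemma measurable_fE:
  assumes X: "\<And>z. z \<in> space N \<Longrightarrow> X z \<in> carrier_vec d"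
    and mX: "\<And>i. i < d \<Longrightarrow> (\<lambda>z. X z $ i) \<in> borel_measurable N"
  shows "(\<lambda>z. fE D A b (X z)) \<in> borel_measurable N"
proof -
  have eq: "fE D A b (X z) = (1/2) * (\<Sum>i<m. \<Sum>j<m. ((\<Sum>l<d. A $$ (i, l) * X z $ l) - b $ i)
      * (\<integral>S. Hmat A S $$ (i, j) \<partial>D) * ((\<Sum>l<d. A $$ (j, l) * X z $ l) - b $ j))"
    if "z \<in> space N" for z
    using X[OF that] by (rule fE_expand)
  show ?thesis
    by (subst measurable_cong[OF eq], assumption, intro borel_measurable_times borel_measurable_sum
      borel_measurable_diff borel_measurable_const mX) simp_all
qed

section \<open>Iterates on the path space\<close>

context
  fixes w beta :: real and x0 xs :: "real vec"
  assumes beta: "0 \<le> beta" "beta < 1" and w: "w > 0" "w + 2 * beta < 2"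
    and x0: "x0 \<in> carrier_vec d" and xs: "xs \<in> carrier_vec d" "fE D A b xs = 0"
begin

abbreviation iter :: "nat \<Rightarrow> (nat \<Rightarrow> real mat) \<Rightarrow> real vec" where
  "iter t Ss \<equiv> shb A b w beta x0 Ss t"

abbreviation path_measure :: "(nat \<Rightarrow> real mat) measure" where
  "path_measure \<equiv> \<Pi>\<^sub>M i\<in>UNIV. D"

lemma iter_carrier: "Ss \<in> space path_measure \<Longrightarrow> iter t Ss \<in> carrier_vec d"
proof (induction t rule: induct_nat_012)
  case (ge2 t)
  then have "dim_row (Ss (Suc t)) = m" using rows by (auto simp: space_PiM PiE_iff)
  then show ?case using ge2 gradS_carrier[OF A b] by simp
qed (use x0 in auto)

lemma measurable_iter: "i < d \<Longrightarrow> (\<lambda>Ss. iter t Ss $ i) \<in> borel_measurable path_measure"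
proof (induction t arbitrary: i rule: induct_nat_012)
  case (ge2 t)
  have h: "(\<lambda>Ss. Ss (Suc t)) \<in> path_measure \<rightarrow>\<^sub>M D"
    by (rule measurable_component_singleton) simp
  have eq: "iter (Suc (Suc t)) Ss $ i = iter (Suc t) Ss $ i
      - w * gradS A b (Ss (Suc t)) (iter (Suc t) Ss) $ i
      + beta * (iter (Suc t) Ss $ i - iter t Ss $ i)" if "Ss \<in> space path_measure" for Ss
  proof -
    have "dim_row (Ss (Suc t)) = m" using that rows by (auto simp: space_PiM PiE_iff)
    from carrier_vecD[OF gradS_carrier[OF A b this]] show ?thesis
      using carrier_vecD[OF iter_carrier[OF that]] ge2.prems by simp
  qed
  show ?case
    by (subst measurable_cong[OF eq], assumption, intro borel_measurable_add borel_measurable_diff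
      borel_measurable_times borel_measurable_const ge2.IH ge2.prems
      measurable_gradS[OF h iter_carrier[where t = "Suc t"] ge2.IH(2)])
qed auto

lemma measurable_fS_iter:
  "(\<lambda>Ss. fS A b (Ss j) (iter t Ss)) \<in> borel_measurable path_measure"
  by (intro measurable_fS iter_carrier measurable_iter measurable_component_singleton) auto

lemma measurable_fE_iter: "(\<lambda>Ss. fE D A b (iter t Ss)) \<in> borel_measurable path_measure"
  by (intro measurable_fE iter_carrier measurable_iter)

text \<open>Resampling coordinate \<open>j\<close> leaves iterate \<open>t\<close> fixed, and
  averaging over the fresh sample turns \<open>fS\<close> into \<open>fE\<close>. The case
  \<open>t = j\<close> is included, since iterate \<open>t\<close> reads only samples below
  \<open>t\<close>.\<close>

lemma nn_integral_fS_iter: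
  assumes "t \<le> j"
  shows "(\<integral>\<^sup>+ Ss. ennreal (fS A b (Ss j) (iter t Ss)) \<partial>path_measure)
    = (\<integral>\<^sup>+ Ss. ennreal (fE D A b (iter t Ss)) \<partial>path_measure)"
proof -
  have "(\<integral>\<^sup>+ Ss. ennreal (fS A b (Ss j) (iter t Ss)) \<partial>path_measure)
      = (\<integral>\<^sup>+ Ss. \<integral>\<^sup>+ s. ennreal (fS A b s (iter t (Ss(j := s)))) \<partial>D \<partial>path_measure)"
    using measurable_fS_iter by (subst nn_integral_PiM_UNIV_split[OF D, where j = j]) auto
  also have "\<dots> = (\<integral>\<^sup>+ Ss. \<integral>\<^sup>+ s. ennreal (fS A b s (iter t Ss)) \<partial>D \<partial>path_measure)"
  proof -
    have "iter t (Ss(j := s)) = iter t Ss" for Ss s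
      using assms by (intro shb_cong) auto
    then show ?thesis by simp
  qed
  also have "\<dots> = (\<integral>\<^sup>+ Ss. ennreal (fE D A b (iter t Ss)) \<partial>path_measure)"
    by (intro nn_integral_cong nn_integral_fS iter_carrier)
  finally show ?thesis .
qed

text \<open>Up to the factor \<^term>\<open>(1 - beta)\<^sup>2\<close>, the squared distance to \<open>xs\<close> of the extrapolated point
  \<open>x\<^sub>n\<^sub>+\<^sub>1 + beta / (1 - beta) * (x\<^sub>n\<^sub>+\<^sub>1 - x\<^sub>n)\<close>, on which a heavy ball step acts as a plain
  gradient step.\<close>

definition lyap :: "nat \<Rightarrow> (nat \<Rightarrow> real mat) \<Rightarrow> real" where
  "lyap n Ss = (let u = (iter (Suc n) Ss - xs) - beta \<cdot>\<^sub>v (iter n Ss - xs) in u \<bullet> u)"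

lemma lyap_nonneg: "0 \<le> lyap n Ss"
  by (simp add: lyap_def Let_def scalar_prod_self_nonneg)

lemma measurable_lyap: "lyap n \<in> borel_measurable path_measure"
proof -
  have eq: "lyap n Ss = (\<Sum>i<d. ((iter (Suc n) Ss $ i - xs $ i) - beta * (iter n Ss $ i - xs $ i))
      * ((iter (Suc n) Ss $ i - xs $ i) - beta * (iter n Ss $ i - xs $ i)))"
    if "Ss \<in> space path_measure" for Ss
    using carrier_vecD[OF iter_carrier[OF that]] xs(1)
    by (simp add: lyap_def scalar_prod_def atLeast0LessThan)
  show ?thesis
    by (subst measurable_cong[OF eq], assumption, intro borel_measurable_times borel_measurable_sum
      borel_measurable_diff borel_measurable_const measurable_iter) simp_all
qed

section \<open>Decrease of the Lyapunov function and the rate\<close>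

text \<open>The step inequality holds wherever the current sample satisfies
  \<open>fS A b S xs = 0\<close>, which is almost sure. Both function values use the sample
  \<open>Ss (Suc n)\<close> of this step.\<close>

lemma lyap_step_pathwise:
  "AE Ss in path_measure.
    lyap (Suc n) Ss + 2 * w * (2 - 2 * beta - w) * fS A b (Ss (Suc n)) (iter (Suc n) Ss)
      + 2 * w * beta * fS A b (Ss (Suc n)) (iter (Suc n) Ss)
    \<le> lyap n Ss + 2 * w * beta * fS A b (Ss (Suc n)) (iter n Ss)"
proof -
  have "AE Ss in path_measure. fS A b (Ss (Suc n)) xs = 0"
    by (rule AE_PiM_component[where P = "\<lambda>S. fS A b S xs = 0"]) (auto intro: D AE_fS_eq_0[OF xs])
  then show ?thesis
  proof (rule AE_mp, intro AE_I2 impI)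
    fix Ss assume Ss: "Ss \<in> space path_measure" and 0: "fS A b (Ss (Suc n)) xs = 0"
    have "dim_row (Ss (Suc n)) = m" using Ss rows by (auto simp: space_PiM PiE_iff)
    from heavy_ball_step[OF A b this iter_carrier[OF Ss] iter_carrier[OF Ss] xs(1) 0 _ beta(1) refl refl refl,
        of w "Suc n" n] w(1)
    show "lyap (Suc n) Ss + 2 * w * (2 - 2 * beta - w) * fS A b (Ss (Suc n)) (iter (Suc n) Ss)
        + 2 * w * beta * fS A b (Ss (Suc n)) (iter (Suc n) Ss)
      \<le> lyap n Ss + 2 * w * beta * fS A b (Ss (Suc n)) (iter n Ss)"
      by (simp add: lyap_def Let_def)
  qed
qed

abbreviation E_lyap :: "nat \<Rightarrow> ennreal" where
  "E_lyap n \<equiv> \<integral>\<^sup>+ Ss. ennreal (lyap n Ss) \<partial>path_measure"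

abbreviation E_f :: "nat \<Rightarrow> ennreal" where
  "E_f t \<equiv> \<integral>\<^sup>+ Ss. ennreal (fE D A b (iter t Ss)) \<partial>path_measure"

lemma lyap_step:
  "E_lyap (Suc n) + ennreal (2 * w * (2 - 2 * beta - w)) * E_f (Suc n)
      + ennreal (2 * w * beta) * E_f (Suc n)
    \<le> E_lyap n + ennreal (2 * w * beta) * E_f n"
proof -
  let ?c = "2 * w * (2 - 2 * beta - w)" and ?e = "2 * w * beta"
  let ?F = "\<lambda>t Ss. fS A b (Ss (Suc n)) (iter t Ss)"
  \<comment> \<open>Here \<open>w + 2 * beta < 2\<close> makes the decrease coefficient
    nonnegative.\<close>
  have ce: "0 \<le> ?c" "0 \<le> ?e" using w beta by auto
  have F: "0 \<le> ?F t Ss" if "Ss \<in> space path_measure" for t Ss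
    using that by (intro fS_space_nonneg iter_carrier) (auto simp: space_PiM PiE_iff)
  note [measurable] = measurable_fS_iter measurable_lyap
  have F_int: "(\<integral>\<^sup>+ Ss. ennreal (?F t Ss) \<partial>path_measure) = E_f t" if "t \<le> Suc n" for t
    by (rule nn_integral_fS_iter[OF that])
  have "E_lyap (Suc n) + ennreal ?c * E_f (Suc n) + ennreal ?e * E_f (Suc n)
      = (\<integral>\<^sup>+ Ss. ennreal (lyap (Suc n) Ss) + ennreal ?c * ennreal (?F (Suc n) Ss)
          + ennreal ?e * ennreal (?F (Suc n) Ss) \<partial>path_measure)"
    by (simp add: nn_integral_add nn_integral_cmult F_int)
  also have "\<dots> \<le> (\<integral>\<^sup>+ Ss. ennreal (lyap n Ss) + ennreal ?e * ennreal (?F n Ss) \<partial>path_measure)"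
  proof (rule nn_integral_mono_AE)
    show "AE Ss in path_measure. ennreal (lyap (Suc n) Ss) + ennreal ?c * ennreal (?F (Suc n) Ss)
          + ennreal ?e * ennreal (?F (Suc n) Ss)
        \<le> ennreal (lyap n Ss) + ennreal ?e * ennreal (?F n Ss)"
      using lyap_step_pathwise[of n] AE_space
    proof eventually_elim
      case (elim Ss)
      then show ?case
        using ce F[OF elim(2)] lyap_nonneg
        by (simp add: ennreal_mult[symmetric] ennreal_plus[symmetric] ennreal_leI del: ennreal_plus)
    qed
  qed
  also have "\<dots> = E_lyap n + ennreal ?e * E_f n"
    by (simp add: nn_integral_add nn_integral_cmult F_int)
  finally show ?thesis .
qed

text \<open>The term with factor \<open>2 * w * beta\<close> belongs to the potential and is handed
  on from step to step; only the middle term accumulates.\<close>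

lemma lyap_sum:
  "E_lyap n + ennreal (2 * w * (2 - 2 * beta - w)) * (\<Sum>t=1..n. E_f t)
      + ennreal (2 * w * beta) * E_f n
    \<le> E_lyap 0 + ennreal (2 * w * beta) * E_f 0"
proof (induction n)
  case (Suc n)
  let ?c = "ennreal (2 * w * (2 - 2 * beta - w))" and ?e = "ennreal (2 * w * beta)"
  have "E_lyap (Suc n) + ?c * (\<Sum>t=1..Suc n. E_f t) + ?e * E_f (Suc n)
      = (E_lyap (Suc n) + ?c * E_f (Suc n) + ?e * E_f (Suc n)) + ?c * (\<Sum>t=1..n. E_f t)"
    by (simp add: distrib_left add_ac)
  also have "\<dots> \<le> (E_lyap n + ?e * E_f n) + ?c * (\<Sum>t=1..n. E_f t)"
    by (intro add_right_mono lyap_step)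
  also have "\<dots> = E_lyap n + ?c * (\<Sum>t=1..n. E_f t) + ?e * E_f n" by (simp add: add_ac)
  finally show ?case using Suc.IH by (rule order_trans)
qed simp

text \<open>Equal starting points give u = (1 - beta)(x0 - xs), which is constant over the
  paths.\<close>

lemma initial_value:
  "E_lyap 0 + ennreal (2 * w * beta) * E_f 0
    = ennreal ((1 - beta)\<^sup>2 * ((x0 - xs) \<bullet> (x0 - xs)) + 2 * w * beta * fE D A b x0)"
proof -
  interpret N: prob_space path_measure by (intro prob_space_PiM D)
  have "(x0 - xs) - beta \<cdot>\<^sub>v (x0 - xs) = (1 - beta) \<cdot>\<^sub>v (x0 - xs)"
    using x0 xs by (auto simp: algebra_simps intro!: eq_vecI)
  then have "lyap 0 Ss = (1 - beta)\<^sup>2 * ((x0 - xs) \<bullet> (x0 - xs))" for Ss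
    using x0 xs by (simp add: lyap_def power2_eq_square)
  then show ?thesis
    using w beta fE_nonneg[OF x0] scalar_prod_self_nonneg[of "x0 - xs"]
    by (simp add: N.emeasure_space_1 ennreal_mult ennreal_plus)
qed

lemma shb_rate:
  assumes k: "k \<ge> 1"
  shows "(\<integral>\<^sup>+ Ss. ennreal (fE D A b (shb_avg d A b w beta x0 Ss k)) \<partial>path_measure)
    \<le> ennreal (((1 - beta)\<^sup>2 * ((x0 - xs) \<bullet> (x0 - xs)) + 2 * w * beta * fE D A b x0)
                / (2 * w * (2 - 2 * beta - w) * real k))"
    (is "?J \<le> ennreal (?B / (?c * real k))")
proof -
  have c: "?c > 0" and B: "?B \<ge> 0"
    using w beta fE_nonneg[OF x0] scalar_prod_self_nonneg[of "x0 - xs"] by auto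
  have avg: "ennreal (fE D A b (shb_avg d A b w beta x0 Ss k))
      \<le> ennreal (1 / real k) * (\<Sum>t=1..k. ennreal (fE D A b (iter t Ss)))"
    if "Ss \<in> space path_measure" for Ss
  proof -
    have "fE D A b (shb_avg d A b w beta x0 Ss k) \<le> (1 / real k) * (\<Sum>t=1..k. fE D A b (iter t Ss))"
      using fE_average[OF iter_carrier[OF that] k] k by (simp add: shb_avg_def field_simps)
    then show ?thesis
      using fE_nonneg[OF iter_carrier[OF that]]
      by (simp add: sum_ennreal ennreal_mult[symmetric] sum_nonneg ennreal_leI)
  qed
  have "?J \<le> (\<integral>\<^sup>+ Ss. ennreal (1 / real k) * (\<Sum>t=1..k. ennreal (fE D A b (iter t Ss))) \<partial>path_measure)"
    by (intro nn_integral_mono avg)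
  also have "\<dots> = ennreal (1 / real k) * (\<Sum>t=1..k. E_f t)"
    using measurable_fE_iter by (simp add: nn_integral_cmult nn_integral_sum)
  \<comment> \<open>The factor \<open>?c\<close> is inserted to match the sum bounded by
    \<open>lyap_sum\<close>.\<close>
  also have "ennreal (1 / real k) = ennreal (1 / (?c * real k)) * ennreal ?c"
    using c k by (subst ennreal_mult[symmetric]) (auto simp del: mult_eq_0_iff)
  also have "\<dots> * (\<Sum>t=1..k. E_f t) = ennreal (1 / (?c * real k)) * (ennreal ?c * (\<Sum>t=1..k. E_f t))"
    by (rule mult.assoc)
  also have "\<dots> \<le> ennreal (1 / (?c * real k)) * ennreal ?B"
  proof (rule mult_left_mono)
    \<comment> \<open>The final potential is nonnegative and is dropped.\<close>
    have "ennreal ?c * (\<Sum>t=1..k. E_f t)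
        \<le> E_lyap k + ennreal ?c * (\<Sum>t=1..k. E_f t) + ennreal (2 * w * beta) * E_f k"
      by (intro add_increasing2 add_increasing zero_le order_refl)
    also have "\<dots> \<le> ennreal ?B" using lyap_sum[of k] by (simp only: initial_value)
    finally show "ennreal ?c * (\<Sum>t=1..k. E_f t) \<le> ennreal ?B" .
  qed simp
  also have "\<dots> = ennreal (?B / (?c * real k))"
    using c B by (simp add: ennreal_mult[symmetric])
  finally show ?thesis .
qed

end

end

theorem theorem2:
  fixes A :: "real mat" and b :: "real vec" and D :: "real mat measure"
    and m d k :: nat and w beta :: real and x0 xs :: "real vec"
  assumes A: "A \<in> carrier_mat m d" and b: "b \<in> carrier_vec m"
    and consistent: "\<exists>x \<in> carrier_vec d. A *\<^sub>v x = b"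
    and D: "prob_space D"
    and rows: "\<forall>S \<in> space D. dim_row S = m"
    and EH: "\<forall>i<m. \<forall>j<m. integrable D (\<lambda>S. Hmat A S $$ (i, j))"
    and beta: "0 \<le> beta" "beta < 1" and w: "w > 0" "w + 2 * beta < 2"
    and x0: "x0 \<in> carrier_vec d"
    and xs: "xs \<in> carrier_vec d" "fE D A b xs = 0"
    and k: "k \<ge> 1"
  shows "(\<integral>\<^sup>+ Ss. ennreal (fE D A b (shb_avg d A b w beta x0 Ss k)) \<partial>(\<Pi>\<^sub>M i\<in>UNIV. D))
    \<le> ennreal (((1 - beta)\<^sup>2 * ((x0 - xs) \<bullet> (x0 - xs)) + 2 * w * beta * fE D A b x0)
                / (2 * w * (2 - 2 * beta - w) * real k))"
  by (rule shb_rate[OF A b D rows EH beta w x0 xs k])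

end
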